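(* Let $M$ be a monoid endowed with a total order $\le$, and $k\ge0$. Let $\equiv_k$ be the equivalence relation on $\mathbf{P}(M)$ with $\mathfrak{p}\equiv_k\mathfrak{p}'$ iff $\mathfrak{p},\mathfrak{p}'$ have the same arity, $\mathfrak{p}'$ is a rearrangement of the letters of $\mathfrak{p}$ (same multiset of pigmented letters), and $\mathrm{first}_k(\mathfrak{p})=\mathrm{first}_k(\mathfrak{p}')$. Then $\mathbb{P}_{\equiv_k}:=\downarrow^{(k)}_2\circ\downarrow^{(k)}_1$ is a $\mathbb{P}$-symbol for $\equiv_k$ and $\mathbb{P}_{\equiv_k}(\mathbf{P}(M))$ is the set of $M$-pigmented $k$-stalactites. Moreover, the graded set $\mathsf{Stal}_k(M):=\mathbf{P}(M)/_{\equiv_k}$ is isomorphic to the graded set of $M$-pigmented $k$-stalactites.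
   Context: Let $(M,\cdot,e)$ be a monoid. An $M$-pigmented letter is a pair $i^\alpha$ with $i$ a positive integer (value) and $\alpha\in M$ (pigment); $\mathbf{P}(M)(n)$ is the set of words of $M$-pigmented letters with values in $[n]$. The total order $\le$ on $M$ induces a total order $\sqsubseteq$ on pigmented letters: $i_1^{\alpha_1}\sqsubseteq i_2^{\alpha_2}$ iff $i_1<i_2$, or $i_1=i_2$ and $\alpha_1\le\alpha_2$. In a word $\mathfrak{p}$, a position $j$ is a left $k$-witness if $\mathfrak{p}(1)\cdots\mathfrak{p}(j-1)$ contains at most $k-1$ letters having the same value as $\mathfrak{p}(j)$; $\mathrm{first}_k(\mathfrak{p})$ is the subword of letters at left $k$-witness positions. Relations on $\mathbf{P}(M)$ (statuses computed in the left-hand word): (1) $\mathfrak{p}\,i_1^{\alpha_1}i_2^{\alpha_2}\,\mathfrak{p}'\leadsto^{(k)}_1\mathfrak{p}\,i_2^{\alpha_2}i_1^{\alpha_1}\,\mathfrak{p}'$ when $i_1\ne i_2$, the position of $i_1^{\alpha_1}$ is not a left $k$-witness and that of $i_2^{\alpha_2}$ is a left $k$-witness; (2) $\mathfrak{p}\,i_1^{\alpha_1}i_2^{\alpha_2}\,\mathfrak{p}'\leadsto^{(k)}_2\mathfrak{p}\,i_2^{\alpha_2}i_1^{\alpha_1}\,\mathfrak{p}'$ when neither displayed position is a left $k$-witness, $i_1^{\alpha_1}\ne i_2^{\alpha_2}$ and $i_2^{\alpha_2}\sqsubseteq i_1^{\alpha_1}$. Let $\preccurlyeq^{(k)}_j$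 be the reflexive transitive closure of $\leadsto^{(k)}_j$; it is a partial order and each $\mathfrak{p}$ lies below exactly one maximal element, denoted $\downarrow^{(k)}_j(\mathfrak{p})$. An $M$-pigmented $k$-stalactite of arity $n$ is an element of $\mathbf{P}(M)(n)$ maximal for both $\preccurlyeq^{(k)}_1$ and $\preccurlyeq^{(k)}_2$. A $\mathbb{P}$-symbol for an equivalence relation $\equiv$ on $\mathbf{P}(M)$ is a map $\mathbb{P}:\mathbf{P}(M)\to\mathbf{P}(M)$ with $\mathfrak{p}\equiv\mathbb{P}(\mathfrak{p})$ for all $\mathfrak{p}$ and such that $\mathfrak{p}\equiv\mathfrak{p}'$ implies $\mathbb{P}(\mathfrak{p})=\mathbb{P}(\mathfrak{p}')$. *)

theory Defs
  imports "HOL-Library.Multiset"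
begin

type_synonym 'm pletter = "nat \<times> 'm"

text \<open>An element of \<open>\<^bold>P(M)\<close> carries its arity: the same list of letters with values in \<open>[n]\<close>
  gives different elements of \<open>\<^bold>P(M)(n)\<close> and of \<open>\<^bold>P(M)(n + 1)\<close>.\<close>
type_synonym 'm pword = "nat \<times> 'm pletter list"

definition pwords :: "nat \<Rightarrow> ('m::monoid_mult) pword set" where
  "pwords n = {(n, w) | w. \<forall>l \<in> set w. fst l \<in> {1..n}}"

definition all_pwords :: "('m::monoid_mult) pword set" where
  "all_pwords = (\<Union>n. pwords n)"

definition pletter_le :: "('m::linorder) pletter \<Rightarrow> 'm pletter \<Rightarrow> bool"  (infix "\<sqsubseteq>" 50) where
  "x \<sqsubseteq> y \<longleftrightarrow> fst x < fst y \<or> (fst x = fst y \<and> snd x \<le> snd y)"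

text \<open>Positions are counted from \<open>0\<close>. ``At most \<open>k - 1\<close>'' is written as \<open>< k\<close>, so that there are
  no left \<open>0\<close>-witnesses.\<close>
definition left_witness :: "nat \<Rightarrow> 'm pletter list \<Rightarrow> nat \<Rightarrow> bool" where
  "left_witness k w j \<longleftrightarrow>
     j < length w \<and> length (filter (\<lambda>l. fst l = fst (w ! j)) (take j w)) < k"

definition first :: "nat \<Rightarrow> 'm pletter list \<Rightarrow> 'm pletter list" where
  "first k w = nths w {j. left_witness k w j}"

definition step1 :: "nat \<Rightarrow> ('m::monoid_mult) pword rel" where
  "step1 k = {((n, p @ [x, y] @ q), (n, p @ [y, x] @ q)) | n p x y q.
     (n, p @ [x, y] @ q) \<in> all_pwords \<and> fst x \<noteq> fst y \<and>
     \<not> left_witness k (p @ [x, y] @ q) (length p) \<and>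
     left_witness k (p @ [x, y] @ q) (length p + 1)}"

definition step2 :: "nat \<Rightarrow> ('m::{monoid_mult,linorder}) pword rel" where
  "step2 k = {((n, p @ [x, y] @ q), (n, p @ [y, x] @ q)) | n p x y q.
     (n, p @ [x, y] @ q) \<in> all_pwords \<and>
     \<not> left_witness k (p @ [x, y] @ q) (length p) \<and>
     \<not> left_witness k (p @ [x, y] @ q) (length p + 1) \<and>
     x \<noteq> y \<and> y \<sqsubseteq> x}"

definition prec1 :: "nat \<Rightarrow> ('m::monoid_mult) pword rel" where
  "prec1 k = Restr ((step1 k)\<^sup>*) all_pwords"

definition prec2 :: "nat \<Rightarrow> ('m::{monoid_mult,linorder}) pword rel" where
  "prec2 k = Restr ((step2 k)\<^sup>*) all_pwords"

definition is_maximal :: "('m::monoid_mult) pword rel \<Rightarrow> 'm pword \<Rightarrow> bool" where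
  "is_maximal R p \<longleftrightarrow> p \<in> all_pwords \<and> (\<forall>q \<in> all_pwords. (p, q) \<in> R \<longrightarrow> q = p)"

definition max_above :: "('m::monoid_mult) pword rel \<Rightarrow> 'm pword \<Rightarrow> 'm pword" where
  "max_above R p = (THE m. is_maximal R m \<and> (p, m) \<in> R)"

definition down1 :: "nat \<Rightarrow> ('m::monoid_mult) pword \<Rightarrow> 'm pword" where
  "down1 k = max_above (prec1 k)"

definition down2 :: "nat \<Rightarrow> ('m::{monoid_mult,linorder}) pword \<Rightarrow> 'm pword" where
  "down2 k = max_above (prec2 k)"

definition stalactites :: "nat \<Rightarrow> nat \<Rightarrow> ('m::{monoid_mult,linorder}) pword set" where
  "stalactites k n = {p \<in> pwords n. is_maximal (prec1 k) p \<and> is_maximal (prec2 k) p}"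

definition stal_equiv :: "nat \<Rightarrow> ('m::monoid_mult) pword rel" where
  "stal_equiv k = {(p, p'). p \<in> all_pwords \<and> p' \<in> all_pwords \<and> fst p = fst p' \<and>
     mset (snd p) = mset (snd p') \<and> first k (snd p) = first k (snd p')}"

definition P_symbol :: "('m::monoid_mult) pword rel \<Rightarrow> ('m pword \<Rightarrow> 'm pword) \<Rightarrow> bool" where
  "P_symbol E f \<longleftrightarrow>
     equiv all_pwords E \<and>
     f ` all_pwords \<subseteq> all_pwords \<and>
     (\<forall>p \<in> all_pwords. (p, f p) \<in> E) \<and>
     (\<forall>p \<in> all_pwords. \<forall>p' \<in> all_pwords. (p, p') \<in> E \<longrightarrow> f p = f p')"

definition Stal :: "nat \<Rightarrow> nat \<Rightarrow> ('m::monoid_mult) pword set set" where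
  "Stal k n = pwords n // stal_equiv k"

definition graded_isomorphic :: "(nat \<Rightarrow> 'a set) \<Rightarrow> (nat \<Rightarrow> 'b set) \<Rightarrow> bool" where
  "graded_isomorphic A B \<longleftrightarrow> (\<exists>\<phi>. \<forall>n. bij_betw (\<phi> n) (A n) (B n))"

definition PP :: "nat \<Rightarrow> ('m::{monoid_mult,linorder}) pword \<Rightarrow> 'm pword" where
  "PP k = down2 k \<circ> down1 k"

end

theory Submission
  imports Defs "HOL-Library.Product_Lexorder"
begin

text \<open>Neither relation changes the witness status of a letter. The first one moves all witnesses
  to the front without reordering witnesses or non-witnesses among themselves, and on a word of
  the resulting shape the second one is bubble sort of the non-witnesses. Hence \<open>PP k\<close> sends a word
  to its left witnesses followed by its sorted non-witnesses, which depends only on the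
  multiset of letters and on \<open>first k\<close>.\<close>

section \<open>Value counts and words with their witnesses in front\<close>

definition cnt :: "nat \<Rightarrow> 'm pletter list \<Rightarrow> nat" where
  "cnt i w = length (filter (\<lambda>l. fst l = i) w)"

definition rest :: "nat \<Rightarrow> 'm pletter list \<Rightarrow> 'm pletter list" where
  "rest k w = nths w {j. \<not> left_witness k w j}"

lemma cnt_simps [simp]:
  "cnt i [] = 0"
  "cnt i (x # w) = (if fst x = i then Suc (cnt i w) else cnt i w)"
  "cnt i (v @ w) = cnt i v + cnt i w"
  by (auto simp: cnt_def)

lemma left_witness_append_Cons:
  "left_witness k (p @ x # q) (length p) \<longleftrightarrow> cnt (fst x) p < k"
  by (simp add: left_witness_def cnt_def)

lemma left_witness_append_Cons_Cons:
  "left_witness k (p @ x # y # q) (Suc (length p)) \<longleftrightarrow> cnt (fst y) (p @ [x]) < k"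
  using left_witness_append_Cons[of k "p @ [x]" y q] by simp

lemma left_witness_append_left:
  "j < length v \<Longrightarrow> left_witness k (v @ w) j \<longleftrightarrow> left_witness k v j"
  by (simp add: left_witness_def nth_append)

lemma first_Nil [simp]: "first k [] = []"
  by (simp add: first_def)

lemma rest_Nil [simp]: "rest k [] = []"
  by (simp add: rest_def)

text \<open>The status of a position depends only on the letters before it, so appending a letter
  disturbs no earlier status. This gives \<open>first\<close> a recursion at the right end, which is
  why the inductions on words run from the right.\<close>

lemma first_snoc:
  "first k (w @ [x]) = first k w @ (if cnt (fst x) w < k then [x] else [])"
proof -
  have "nths w {j. left_witness k (w @ [x]) j} = nths w {j. left_witness k w j}"
    unfolding nths_def
    by (intro arg_cong[where f = "map fst"] filter_cong refl)
      (auto simp: set_zip left_witness_append_left)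
  then show ?thesis
    by (simp add: first_def nths_append left_witness_append_Cons)
qed

lemma rest_snoc:
  "rest k (w @ [x]) = rest k w @ (if cnt (fst x) w < k then [] else [x])"
proof -
  have "nths w {j. \<not> left_witness k (w @ [x]) j} = nths w {j. \<not> left_witness k w j}"
    unfolding nths_def
    by (intro arg_cong[where f = "map fst"] filter_cong refl)
      (auto simp: set_zip left_witness_append_left)
  then show ?thesis
    by (simp add: rest_def nths_append left_witness_append_Cons)
qed

lemma mset_first_rest: "mset (first k w) + mset (rest k w) = mset w"
  by (induction w rule: rev_induct) (auto simp: first_snoc rest_snoc)

text \<open>The witnesses of a given value are its first \<open>k\<close> occurrences, or all of
  them if there are fewer.\<close>

lemma cnt_first: "cnt i (first k w) = min k (cnt i w)"
  by (induction w rule: rev_induct) (auto simp: first_snoc)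

lemma cnt_rest: "z \<in> set (rest k w) \<Longrightarrow> k \<le> cnt (fst z) w"
  by (induction w rule: rev_induct) (auto simp: rest_snoc split: if_splits)

text \<open>The words \<open>a @ r\<close> whose left \<open>k\<close>-witnesses are exactly the letters of \<open>a\<close>.\<close>

definition tidy :: "nat \<Rightarrow> 'm pletter list \<Rightarrow> 'm pletter list \<Rightarrow> bool" where
  "tidy k a r \<longleftrightarrow> (\<forall>i. cnt i a \<le> k) \<and> (\<forall>z \<in> set r. k \<le> cnt (fst z) a)"

text \<open>A value with a non-witness occurs at least \<open>k\<close> times, so exactly
  \<open>k\<close> of its occurrences lie in \<open>first k w\<close>.\<close>

lemma tidy_first_rest: "tidy k (first k w) (rest k w)"
  by (auto simp: tidy_def cnt_first dest: cnt_rest)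

lemma tidy_mset_cong: "tidy k a r \<Longrightarrow> mset r' = mset r \<Longrightarrow> tidy k a r'"
  unfolding tidy_def by (metis set_mset_mset)

text \<open>A letter of \<open>a\<close> is itself one of the at most \<open>k\<close> letters of
  its value in \<open>a\<close>, so fewer than \<open>k\<close> precede it. A letter of
  \<open>r\<close> has all of \<open>a\<close> before it, which already holds \<open>k\<close>
  letters of its value.\<close>

lemma left_witness_tidy:
  assumes "tidy k a r" "j < length (a @ r)"
  shows "left_witness k (a @ r) j \<longleftrightarrow> j < length a"
proof (cases "j < length a")
  case True
  let ?i = "fst (a ! j)"
  have "cnt ?i a = cnt ?i (take j a @ a ! j # drop (Suc j) a)"
    using id_take_nth_drop[OF True] by simp
  then have "cnt ?i (take j a) < cnt ?i a" by simp
  also have "\<dots> \<le> k" using assms(1) by (simp add: tidy_def)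
  finally show ?thesis using True by (simp add: left_witness_def nth_append cnt_def)
next
  case False
  then have "r ! (j - length a) \<in> set r" using assms(2) by (intro nth_mem) auto
  then have "k \<le> cnt (fst (r ! (j - length a))) a" using assms(1) by (simp add: tidy_def)
  then show ?thesis using False by (simp add: left_witness_def nth_append cnt_def)
qed

lemma first_tidy:
  assumes "tidy k a r"
  shows "first k (a @ r) = a"
proof -
  have "{j. left_witness k (a @ r) j} = {..<length a}"
  proof (intro set_eqI iffI)
    fix j assume j: "j \<in> {j. left_witness k (a @ r) j}"
    then have "j < length (a @ r)" by (simp add: left_witness_def)
    with j left_witness_tidy[OF assms] show "j \<in> {..<length a}" by blast
  next
    fix j assume "j \<in> {..<length a}"
    then show "j \<in> {j. left_witness k (a @ r) j}" using left_witness_tidy[OF assms, of j] by simp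
  qed
  then show ?thesis by (simp add: first_def)
qed

section \<open>Membership of words, and the two steps in terms of value counts\<close>

lemma all_pwords_iff: "(n, w) \<in> all_pwords \<longleftrightarrow> (\<forall>l \<in> set w. fst l \<in> {1..n})"
  by (auto simp: all_pwords_def pwords_def)

lemma pwords_iff: "(m, w) \<in> pwords n \<longleftrightarrow> m = n \<and> (m, w) \<in> all_pwords"
  by (auto simp: all_pwords_def pwords_def)

lemma pwords_imp_all_pwords: "p \<in> pwords n \<Longrightarrow> p \<in> all_pwords"
  by (auto simp: all_pwords_def)

lemma all_pwords_mset_cong:
  "(n, w) \<in> all_pwords \<Longrightarrow> mset v = mset w \<Longrightarrow> (n, v) \<in> all_pwords"
  unfolding all_pwords_iff by (metis set_mset_mset)

text \<open>The inequality of values demanded by \<open>step1\<close> comes from the counts: if the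
  values agreed, at least \<open>k + 1\<close> letters of that value would precede
  \<open>y\<close>.\<close>

lemma step1I:
  "(n, p @ x # y # q) \<in> all_pwords \<Longrightarrow> k \<le> cnt (fst x) p \<Longrightarrow> cnt (fst y) (p @ [x]) < k
   \<Longrightarrow> ((n, p @ x # y # q), (n, p @ y # x # q)) \<in> step1 k"
  unfolding step1_def mem_Collect_eq
  by (rule exI[of _ n], rule exI[of _ p], rule exI[of _ x], rule exI[of _ y], rule exI[of _ q])
    (auto simp: left_witness_append_Cons left_witness_append_Cons_Cons)

lemma step1E:
  assumes "((n, v), u) \<in> step1 k"
  obtains p x y q where "v = p @ x # y # q" "u = (n, p @ y # x # q)"
    "fst x \<noteq> fst y" "k \<le> cnt (fst x) p" "cnt (fst y) p < k"
proof -
  obtain p x y q where "v = p @ [x, y] @ q" "u = (n, p @ [y, x] @ q)" "fst x \<noteq> fst y"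
    "\<not> left_witness k (p @ [x, y] @ q) (length p)"
    "left_witness k (p @ [x, y] @ q) (length p + 1)"
    using assms unfolding step1_def by blast
  then show thesis
    using that[of p x y q] by (simp add: left_witness_append_Cons left_witness_append_Cons_Cons)
qed

text \<open>The order \<open><\<close> on pairs is lexicographic, hence the strict part of
  \<open>\<sqsubseteq>\<close>; using it makes \<open>insort\<close> and \<open>sort\<close>
  available for letters. Inserting \<open>x\<close> before \<open>y\<close> can only raise the count
  for \<open>y\<close>.\<close>

lemma step2I:
  "(n, p @ x # y # q) \<in> all_pwords \<Longrightarrow> k \<le> cnt (fst x) p \<Longrightarrow> k \<le> cnt (fst y) p \<Longrightarrow> y < x
   \<Longrightarrow> ((n, p @ x # y # q), (n, p @ y # x # q)) \<in> step2 k"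
  unfolding step2_def mem_Collect_eq
  by (rule exI[of _ n], rule exI[of _ p], rule exI[of _ x], rule exI[of _ y], rule exI[of _ q])
    (auto simp: left_witness_append_Cons left_witness_append_Cons_Cons pletter_le_def
      less_prod_def')

lemma step2E:
  assumes "((n, v), u) \<in> step2 k"
  obtains p x y q where "v = p @ x # y # q" "u = (n, p @ y # x # q)"
    "\<not> left_witness k v (length p)" "y < x"
proof -
  obtain p x y q where e: "v = p @ [x, y] @ q" "u = (n, p @ [y, x] @ q)"
    and w: "\<not> left_witness k (p @ [x, y] @ q) (length p)" and l: "x \<noteq> y" "y \<sqsubseteq> x"
    using assms unfolding step2_def by blast
  from l have "y < x" by (auto simp: pletter_le_def less_prod_def' prod_eq_iff)
  with e w show thesis using that[of p x y q] by simp
qed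

section \<open>The first relation: invariants, normal form and \<open>down1\<close>\<close>

text \<open>The swapped letters have different values, so neither counts towards the status of the
  other, and later letters see the same counts. A witness thus passes a non-witness, and each of the
  two subsequences keeps its order.\<close>

lemma first_rest_step1:
  assumes "((n, v), (m, u)) \<in> step1 k"
  shows "m = n" "first k u = first k v" "rest k u = rest k v"
proof -
  obtain p x y q where e: "v = p @ x # y # q" "u = p @ y # x # q" "m = n"
    and c: "fst x \<noteq> fst y" "k \<le> cnt (fst x) p" "cnt (fst y) p < k"
    using assms by (elim step1E) auto
  have "first k (p @ y # x # q) = first k (p @ x # y # q) \<and>
    rest k (p @ y # x # q) = rest k (p @ x # y # q)"
  proof (induction q rule: rev_induct)
    case Nil
    \<comment> \<open>Rebracketing lets the right-end recursions apply twice.\<close>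
    have "p @ [x, y] = (p @ [x]) @ [y]" "p @ [y, x] = (p @ [y]) @ [x]" by simp_all
    then show ?case using c by (simp only: first_snoc rest_snoc) simp
  next
    case (snoc z q)
    then show ?case
      using first_snoc[of k "p @ x # y # q" z] first_snoc[of k "p @ y # x # q" z]
        rest_snoc[of k "p @ x # y # q" z] rest_snoc[of k "p @ y # x # q" z]
      by simp
  qed
  with e show "m = n" "first k u = first k v" "rest k u = rest k v" by auto
qed

lemma first_rest_step1_rtrancl:
  assumes "((n, v), (m, u)) \<in> (step1 k)\<^sup>*"
  shows "m = n \<and> first k u = first k v \<and> rest k u = rest k v"
  using assms
proof (induction "(m, u)" arbitrary: m u rule: rtrancl_induct)
  case base
  then show ?case by simp
next
  case (step z)
  obtain n' w where z: "z = (n', w)" by (cases z)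
  show ?case using step.hyps(3)[OF z] first_rest_step1[OF step.hyps(2)[unfolded z]] by simp
qed

text \<open>Statuses look only to the left, so every step survives an added last letter; the bound
  on the value of \<open>z\<close> keeps the words within arity \<open>n\<close>.\<close>

lemma step1_snoc:
  assumes "((n, v), (m, u)) \<in> (step1 k)\<^sup>*" "fst z \<in> {1..n}"
  shows "((n, v @ [z]), (m, u @ [z])) \<in> (step1 k)\<^sup>*"
  using assms
proof (induction "(m, u)" arbitrary: m u rule: rtrancl_induct)
  case base
  then show ?case by simp
next
  case (step t)
  obtain n' w where t: "t = (n', w)" by (cases t)
  have [simp]: "n' = n" using first_rest_step1_rtrancl[of n v n' w k] step.hyps(1) t by simp
  have "(n, w) \<in> all_pwords" using step.hyps(2) t by (auto simp: step1_def)
  then have w: "(n, w @ [z]) \<in> all_pwords" using step.prems by (simp add: all_pwords_iff)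
  obtain p x y q where "w = p @ x # y # q" "(m, u) = (n, p @ y # x # q)"
    "fst x \<noteq> fst y" "k \<le> cnt (fst x) p" "cnt (fst y) p < k"
    using step.hyps(2) unfolding t \<open>n' = n\<close> by (elim step1E)
  then have "((n, w @ [z]), (m, u @ [z])) \<in> step1 k"
    using step1I[of n p x y "q @ [z]" k] w by simp
  with step.hyps(3)[of n' w] step.prems t show ?case
    by (auto intro: rtrancl_into_rtrancl)
qed

text \<open>The witness \<open>x\<close> moves left across all of \<open>r\<close>: the letters of
  \<open>r\<close> are non-witnesses on account of \<open>a\<close> alone, and their values differ
  from that of \<open>x\<close>, which occurs fewer than \<open>k\<close> times in
  \<open>a\<close>.\<close>

lemma step1_bubble:
  assumes "(n, a @ r @ [x]) \<in> all_pwords" "cnt (fst x) (a @ r) < k"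
    "\<forall>z \<in> set r. k \<le> cnt (fst z) a"
  shows "((n, a @ r @ [x]), (n, a @ x # r)) \<in> (step1 k)\<^sup>*"
  using assms
proof (induction r rule: rev_induct)
  case Nil
  then show ?case by simp
next
  case (snoc z r)
  have nz: "fst z \<noteq> fst x" using snoc.prems by auto
  \<comment> \<open>First \<open>x\<close> passes the last letter \<open>z\<close>; the remaining
    swaps come from the induction hypothesis with \<open>z\<close> appended again.\<close>
  have "((n, (a @ r) @ z # x # []), (n, (a @ r) @ x # z # [])) \<in> step1 k"
    using snoc.prems nz by (intro step1I) auto
  moreover have "((n, a @ r @ [x]), (n, a @ x # r)) \<in> (step1 k)\<^sup>*"
    using snoc.prems by (intro snoc.IH) (auto simp: all_pwords_iff)
  then have "((n, (a @ r @ [x]) @ [z]), (n, (a @ x # r) @ [z])) \<in> (step1 k)\<^sup>*"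
    using snoc.prems(1) by (intro step1_snoc) (auto simp: all_pwords_iff)
  ultimately show ?case by (simp add: converse_rtrancl_into_rtrancl)
qed

text \<open>Rearrange the prefix \<open>w\<close> by induction; then the last letter stays where it
  is if it is a non-witness, and otherwise moves left to the end of
  \<open>first k w\<close>.\<close>

lemma step1_reaches:
  "(n, w) \<in> all_pwords \<Longrightarrow> ((n, w), (n, first k w @ rest k w)) \<in> (step1 k)\<^sup>*"
proof (induction w rule: rev_induct)
  case Nil
  then show ?case by simp
next
  case (snoc x w)
  have x: "fst x \<in> {1..n}" and w: "(n, w) \<in> all_pwords"
    using snoc.prems by (auto simp: all_pwords_iff)
  have r: "((n, w @ [x]), (n, (first k w @ rest k w) @ [x])) \<in> (step1 k)\<^sup>*"
    by (rule step1_snoc[OF snoc.IH[OF w] x])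
  show ?case
  proof (cases "cnt (fst x) w < k")
    case True
    have m: "mset (first k w @ rest k w @ [x]) = mset (w @ [x])"
      using mset_first_rest[of k w] by simp
    \<comment> \<open>The status of \<open>x\<close> was computed in \<open>w\<close>; rearranging
      the prefix leaves the count unchanged.\<close>
    have "mset (filter (\<lambda>l. fst l = fst x) (first k w @ rest k w)) =
      mset (filter (\<lambda>l. fst l = fst x) w)"
      using mset_first_rest[of k w] by (metis mset_append mset_filter)
    then have "cnt (fst x) (first k w @ rest k w) = cnt (fst x) w"
      unfolding cnt_def by (rule mset_eq_length)
    then have "((n, first k w @ rest k w @ [x]), (n, first k w @ x # rest k w)) \<in> (step1 k)\<^sup>*"
      using True tidy_first_rest[of k w] all_pwords_mset_cong[OF snoc.prems m]
      by (intro step1_bubble) (auto simp: tidy_def)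
    with r True show ?thesis by (simp add: first_snoc rest_snoc)
  next
    case False
    with r show ?thesis by (simp add: first_snoc rest_snoc)
  qed
qed

lemma max_above_eq:
  assumes "is_maximal R m" "(p, m) \<in> R" "\<And>m'. is_maximal R m' \<Longrightarrow> (p, m') \<in> R \<Longrightarrow> m' = m"
  shows "max_above R p = m"
  unfolding max_above_def using assms by (blast intro: the_equality)

lemma is_maximal_Restr_rtrancl:
  assumes "p \<in> all_pwords" "\<And>q. (p, q) \<notin> S"
  shows "is_maximal (Restr (S\<^sup>*) all_pwords) p"
  using assms unfolding is_maximal_def by (blast elim: converse_rtranclE[of p])

text \<open>A step needs a non-witness directly followed by a witness, whereas here the witnesses
  form an initial segment.\<close>

lemma is_maximal_prec1_tidy:
  assumes "tidy k a r" "(n, a @ r) \<in> all_pwords"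
  shows "is_maximal (prec1 k) (n, a @ r)"
  unfolding prec1_def
proof (rule is_maximal_Restr_rtrancl[OF assms(2)])
  fix u
  show "((n, a @ r), u) \<notin> step1 k"
  proof
    assume "((n, a @ r), u) \<in> step1 k"
    then obtain p x y q where e: "a @ r = p @ x # y # q"
      and c: "fst x \<noteq> fst y" "k \<le> cnt (fst x) p" "cnt (fst y) p < k"
      by (elim step1E)
    have l: "length p < length (a @ r)" "Suc (length p) < length (a @ r)"
      unfolding e by simp_all
    have "\<not> left_witness k (a @ r) (length p)" "left_witness k (a @ r) (Suc (length p))"
      using c unfolding e by (simp_all add: left_witness_append_Cons left_witness_append_Cons_Cons)
    with l show False by (simp add: left_witness_tidy[OF assms(1)])
  qed
qed

lemma all_pwords_first_rest:
  "(n, w) \<in> all_pwords \<Longrightarrow> (n, first k w @ rest k w) \<in> all_pwords"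
  by (erule all_pwords_mset_cong) (simp add: mset_first_rest)

lemma prec1_maximal_eq:
  assumes "is_maximal (prec1 k) (n, w)"
  shows "w = first k w @ rest k w"
proof -
  have "(n, w) \<in> all_pwords" using assms by (simp add: is_maximal_def)
  then show ?thesis
    using assms step1_reaches[of n w k] all_pwords_first_rest[of n w k]
    by (auto simp: is_maximal_def prec1_def)
qed

lemma down1_eq:
  assumes "(n, w) \<in> all_pwords"
  shows "down1 k (n, w) = (n, first k w @ rest k w)"
  unfolding down1_def
proof (rule max_above_eq)
  show "is_maximal (prec1 k) (n, first k w @ rest k w)"
    by (intro is_maximal_prec1_tidy tidy_first_rest all_pwords_first_rest assms)
  show "((n, w), (n, first k w @ rest k w)) \<in> prec1 k"
    using assms by (simp add: prec1_def step1_reaches all_pwords_first_rest)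
  fix m assume m: "is_maximal (prec1 k) m" "((n, w), m) \<in> prec1 k"
  obtain n' u where [simp]: "m = (n', u)" by (cases m)
  \<comment> \<open>Uniqueness: a maximal word is determined by its two subsequences, and these are
    invariant.\<close>
  have "n' = n \<and> first k u = first k w \<and> rest k u = rest k w"
    using m(2) by (intro first_rest_step1_rtrancl) (auto simp: prec1_def)
  with prec1_maximal_eq[of k n' u] m(1) show "m = (n, first k w @ rest k w)" by simp
qed

section \<open>The second relation as sorting, and \<open>down2\<close>\<close>

text \<open>Each comparison made by \<open>insort\<close> that moves \<open>x\<close> to the right
  is one swap. The letters passed are absorbed into \<open>a\<close>, so the induction generalises
  over \<open>a\<close>.\<close>

lemma step2_insort:
  assumes "(n, a @ x # s) \<in> all_pwords" "\<forall>z \<in> set (x # s). k \<le> cnt (fst z) a"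
  shows "((n, a @ x # s), (n, a @ insort x s)) \<in> (step2 k)\<^sup>*"
  using assms
proof (induction s arbitrary: a)
  case Nil
  then show ?case by simp
next
  case (Cons y s)
  show ?case
  proof (cases "x \<le> y")
    case True
    then show ?thesis by simp
  next
    case False
    then have "((n, a @ x # y # s), (n, a @ y # x # s)) \<in> step2 k"
      using Cons.prems by (intro step2I) auto
    moreover have "((n, (a @ [y]) @ x # s), (n, (a @ [y]) @ insort x s)) \<in> (step2 k)\<^sup>*"
      using Cons.prems by (intro Cons.IH) (auto simp: all_pwords_iff)
    ultimately show ?thesis using False by (simp add: converse_rtrancl_into_rtrancl)
  qed
qed

text \<open>Insertion sort: with \<open>x\<close> counted as part of the prefix the tail is sorted
  by induction, and then \<open>x\<close> is inserted.\<close>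

lemma step2_reaches_sort:
  assumes "(n, a @ r) \<in> all_pwords" "\<forall>z \<in> set r. k \<le> cnt (fst z) a"
  shows "((n, a @ r), (n, a @ sort r)) \<in> (step2 k)\<^sup>*"
  using assms
proof (induction r arbitrary: a)
  case Nil
  then show ?case by simp
next
  case (Cons x r)
  have "((n, (a @ [x]) @ r), (n, (a @ [x]) @ sort r)) \<in> (step2 k)\<^sup>*"
    using Cons.prems by (intro Cons.IH) auto
  moreover have "((n, a @ x # sort r), (n, a @ insort x (sort r))) \<in> (step2 k)\<^sup>*"
    using Cons.prems by (intro step2_insort) (auto simp: all_pwords_iff)
  ultimately show ?case by simp
qed

text \<open>The left letter of the swap is a non-witness, so it lies beyond \<open>a\<close> and the
  whole swap takes place inside \<open>r\<close>.\<close>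

lemma step2_tidyE:
  assumes "tidy k a r" "((n, a @ r), u) \<in> step2 k"
  obtains p x y q where "r = p @ x # y # q" "u = (n, a @ p @ y # x # q)" "y < x"
proof -
  obtain p x y q where e: "a @ r = p @ x # y # q" "u = (n, p @ y # x # q)"
    and c: "\<not> left_witness k (a @ r) (length p)" "y < x"
    using assms(2) by (elim step2E)
  have "length p < length (a @ r)" unfolding e(1) by simp
  with c(1) have "length a \<le> length p" by (simp add: left_witness_tidy[OF assms(1)])
  with e(1) obtain p' where "p = a @ p'" "r = p' @ x # y # q"
    by (auto simp: append_eq_append_conv2 Cons_eq_append_conv)
  with e c that show thesis by simp
qed

lemma step2_tidy_rtrancl:
  assumes "tidy k a r" "((n, a @ r), u) \<in> (step2 k)\<^sup>*"
  shows "\<exists>r'. u = (n, a @ r') \<and> mset r' = mset r"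
  using assms(2)
proof (induction rule: rtrancl_induct)
  case base
  then show ?case by simp
next
  case (step v u)
  then obtain r' where r': "v = (n, a @ r')" "mset r' = mset r" by blast
  with step.hyps(2) tidy_mset_cong[OF assms(1) r'(2)]
  obtain p x y q where "r' = p @ x # y # q" "u = (n, a @ p @ y # x # q)"
    by (auto elim: step2_tidyE)
  with r' show ?case by (intro exI[of _ "p @ y # x # q"]) (auto simp: add_mset_commute)
qed

text \<open>A step would exhibit an adjacent descent in \<open>r\<close>.\<close>

lemma is_maximal_prec2_tidy_sorted:
  assumes "tidy k a r" "sorted r" "(n, a @ r) \<in> all_pwords"
  shows "is_maximal (prec2 k) (n, a @ r)"
  unfolding prec2_def
proof (rule is_maximal_Restr_rtrancl[OF assms(3)])
  fix u
  show "((n, a @ r), u) \<notin> step2 k"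
    using assms(2) by (auto simp: sorted_append elim!: step2_tidyE[OF assms(1)])
qed

lemma prec2_maximal_tidy_eq:
  assumes "tidy k a r" "is_maximal (prec2 k) (n, a @ r)"
  shows "r = sort r"
proof -
  have "(n, a @ r) \<in> all_pwords" using assms(2) by (simp add: is_maximal_def)
  then show ?thesis
    using assms step2_reaches_sort[of n a r k]
    by (auto simp: is_maximal_def prec2_def tidy_def all_pwords_iff)
qed

lemma down2_eq:
  assumes "tidy k a r" "(n, a @ r) \<in> all_pwords"
  shows "down2 k (n, a @ r) = (n, a @ sort r)"
  unfolding down2_def
proof (rule max_above_eq)
  have s: "(n, a @ sort r) \<in> all_pwords" using assms(2) by (simp add: all_pwords_iff)
  show "is_maximal (prec2 k) (n, a @ sort r)"
    using tidy_mset_cong[OF assms(1)] s by (intro is_maximal_prec2_tidy_sorted) auto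
  show "((n, a @ r), (n, a @ sort r)) \<in> prec2 k"
    using assms s by (simp add: prec2_def step2_reaches_sort tidy_def)
  fix m assume m: "is_maximal (prec2 k) m" "((n, a @ r), m) \<in> prec2 k"
  from m(2) obtain r' where r': "m = (n, a @ r')" "mset r' = mset r"
    using step2_tidy_rtrancl[OF assms(1), of n m] unfolding prec2_def by blast
  with m(1) have "r' = sort r'"
    using prec2_maximal_tidy_eq[of k a r' n] tidy_mset_cong[OF assms(1)] by simp
  \<comment> \<open>A sorted list over a total order is determined by its multiset, which gives
    uniqueness of the maximal element.\<close>
  then have "r' = sort r" using r'(2) by (metis properties_for_sort sorted_sort)
  with r'(1) show "m = (n, a @ sort r)" by simp
qed

section \<open>The normal form \<open>PP\<close> and its compatibility with the equivalence\<close>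

lemma tidy_first_sort_rest: "tidy k (first k w) (sort (rest k w))"
  by (rule tidy_mset_cong[OF tidy_first_rest]) simp

lemma mset_first_sort_rest: "mset (first k w @ sort (rest k w)) = mset w"
  by (simp add: mset_first_rest)

lemma PP_eq:
  assumes "(n, w) \<in> all_pwords"
  shows "PP k (n, w) = (n, first k w @ sort (rest k w))"
  using assms
  by (simp add: PP_def down1_eq down2_eq tidy_first_rest all_pwords_first_rest)

lemma PP_in_all_pwords: "p \<in> all_pwords \<Longrightarrow> PP k p \<in> all_pwords"
  by (cases p) (simp add: PP_eq all_pwords_mset_cong[OF _ mset_first_sort_rest])

lemma equiv_stal_equiv: "equiv all_pwords (stal_equiv k)"
  by (auto simp: equiv_def refl_on_def sym_def trans_def stal_equiv_def)

lemma stal_equiv_PP: "p \<in> all_pwords \<Longrightarrow> (p, PP k p) \<in> stal_equiv k"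
  using PP_in_all_pwords[of p k]
  by (cases p)
    (simp add: PP_eq stal_equiv_def first_tidy tidy_first_sort_rest mset_first_rest)

lemma PP_eq_if_stal_equiv:
  assumes "(p, p') \<in> stal_equiv k"
  shows "PP k p = PP k p'"
proof -
  obtain n w n' w' where p: "p = (n, w)" "p' = (n', w')" by (cases p, cases p')
  have e: "n' = n" "mset w' = mset w" "first k w' = first k w"
    and mem: "(n, w) \<in> all_pwords" "(n', w') \<in> all_pwords"
    using assms by (auto simp: p stal_equiv_def)
  \<comment> \<open>The non-witnesses are, as a multiset, all letters minus the witnesses, so
    cancellation applies.\<close>
  have "mset (rest k w') = mset (rest k w)"
    using mset_first_rest[of k w] mset_first_rest[of k w'] e by (metis add_left_cancel)
  then have "sort (rest k w') = sort (rest k w)"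
    by (metis mset_sort properties_for_sort sorted_sort)
  with e mem show ?thesis by (simp add: p PP_eq)
qed

section \<open>Stalactites as the fixed points of \<open>PP\<close> and as class
  representatives\<close>

lemma PP_in_stalactites:
  assumes "p \<in> pwords n"
  shows "PP k p \<in> stalactites k n"
proof -
  obtain w where p: "p = (n, w)" "(n, w) \<in> all_pwords"
    using assms by (cases p) (auto simp: pwords_iff)
  then have "(n, first k w @ sort (rest k w)) \<in> all_pwords"
    using PP_in_all_pwords[of p k] by (simp add: PP_eq)
  with p show ?thesis
    by (simp add: PP_eq stalactites_def pwords_iff is_maximal_prec1_tidy
        is_maximal_prec2_tidy_sorted tidy_first_sort_rest)
qed

text \<open>Maximality for the first relation puts the witnesses in front, and maximality for the
  second then forces the remainder to be sorted, which is the form that \<open>PP\<close>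
  produces.\<close>

lemma PP_stalactite:
  assumes "p \<in> stalactites k n"
  shows "PP k p = p"
proof -
  obtain w where p: "p = (n, w)" "(n, w) \<in> all_pwords"
    and m: "is_maximal (prec1 k) (n, w)" "is_maximal (prec2 k) (n, w)"
    using assms by (cases p) (auto simp: stalactites_def pwords_iff)
  have e: "w = first k w @ rest k w" by (rule prec1_maximal_eq[OF m(1)])
  then have "rest k w = sort (rest k w)"
    using m(2) by (intro prec2_maximal_tidy_eq[OF tidy_first_rest]) simp
  with e p show ?thesis by (simp add: PP_eq)
qed

text \<open>Every class contains exactly one stalactite: \<open>PP\<close> of any member is one, and
  two equivalent stalactites have the same image under \<open>PP\<close>, which fixes both.\<close>

lemma bij_betw_stalactites_Stal:
  "bij_betw (\<lambda>p. stal_equiv k `` {p})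
     (stalactites k n :: 'm::{monoid_mult,linorder} pword set) (Stal k n)"
  unfolding bij_betw_def
proof
  show "inj_on (\<lambda>p. stal_equiv k `` {p}) (stalactites k n :: 'm pword set)"
  proof (rule inj_onI)
    fix p q assume pq: "p \<in> stalactites k n" "q \<in> stalactites k n"
      "stal_equiv k `` {p} = stal_equiv k `` {q}"
    then have "p \<in> all_pwords" "q \<in> all_pwords"
      by (auto simp: stalactites_def intro: pwords_imp_all_pwords)
    with pq(3) have "(p, q) \<in> stal_equiv k"
      using equiv_stal_equiv eq_equiv_class_iff by metis
    then show "p = q" using pq PP_eq_if_stal_equiv PP_stalactite by metis
  qed
  show "(\<lambda>p. stal_equiv k `` {p}) ` (stalactites k n :: 'm pword set) = Stal k n"
  proof
    show "(\<lambda>p. stal_equiv k `` {p}) ` (stalactites k n :: 'm pword set) \<subseteq> Stal k n"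
      by (auto simp: Stal_def stalactites_def intro: quotientI)
    show "Stal k n \<subseteq> (\<lambda>p. stal_equiv k `` {p}) ` (stalactites k n :: 'm pword set)"
    proof
      fix c :: "'m pword set" assume "c \<in> Stal k n"
      then obtain p where p: "p \<in> pwords n" "c = stal_equiv k `` {p}"
        by (auto simp: Stal_def elim: quotientE)
      then have "c = stal_equiv k `` {PP k p}"
        using equiv_class_eq[OF equiv_stal_equiv stal_equiv_PP[OF pwords_imp_all_pwords]] by simp
      with PP_in_stalactites[OF p(1)]
      show "c \<in> (\<lambda>p. stal_equiv k `` {p}) ` stalactites k n" by blast
    qed
  qed
qed

theorem theorem5p2p6:
  fixes k :: nat
  shows "P_symbol (stal_equiv k) (PP k :: 'm::{monoid_mult,linorder} pword \<Rightarrow> 'm pword) \<and>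
    (PP k :: 'm pword \<Rightarrow> 'm pword) ` all_pwords = (\<Union>n. stalactites k n) \<and>
    graded_isomorphic (Stal k :: nat \<Rightarrow> 'm pword set set)
      (stalactites k :: nat \<Rightarrow> 'm pword set)"
proof (intro conjI)
  show "P_symbol (stal_equiv k) (PP k :: 'm pword \<Rightarrow> 'm pword)"
    unfolding P_symbol_def
    using equiv_stal_equiv PP_in_all_pwords stal_equiv_PP PP_eq_if_stal_equiv by blast
  show "(PP k :: 'm pword \<Rightarrow> 'm pword) ` all_pwords = (\<Union>n. stalactites k n)"
  proof
    show "(PP k :: 'm pword \<Rightarrow> 'm pword) ` all_pwords \<subseteq> (\<Union>n. stalactites k n)"
      unfolding all_pwords_def using PP_in_stalactites by blast
    show "(\<Union>n. stalactites k n) \<subseteq> (PP k :: 'm pword \<Rightarrow> 'm pword) ` all_pwords"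
    proof
      fix p :: "'m pword" assume "p \<in> (\<Union>n. stalactites k n)"
      then obtain n where "p \<in> stalactites k n" by blast
      then have "p = PP k p" "p \<in> all_pwords"
        by (auto simp: PP_stalactite) (auto simp: stalactites_def all_pwords_def)
      then show "p \<in> PP k ` all_pwords" by (rule image_eqI)
    qed
  qed
  show "graded_isomorphic (Stal k :: nat \<Rightarrow> 'm pword set set)
      (stalactites k :: nat \<Rightarrow> 'm pword set)"
    unfolding graded_isomorphic_def
    \<comment> \<open>The isomorphism runs from classes to stalactites, so in each arity it is the
      inverse of the class map.\<close>
    by (intro exI[of _ "\<lambda>n. inv_into (stalactites k n) (\<lambda>p. stal_equiv k `` {p})"] allI
        bij_betw_inv_into bij_betw_stalactites_Stal)
qed

end
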